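(* Let $|\psi\rangle$ be a normalized three-qubit pure state with genuine tripartite entanglement (all three one-qubit reduced density matrices have rank 2) that is real, i.e. locally unitarily equivalent to a state whose coefficients in the computational basis are all real. Then there exist a unitary $U\in U(2)$ and real numbers $0<x,y<1$ with $x\neq y$ such that the 2-outcome POVM on the first qubit $$A_0=\begin{pmatrix}\sqrt{x}&0\\0&\sqrt{y}\end{pmatrix}U,\qquad A_1=\begin{pmatrix}\sqrt{1-x}&0\\0&\sqrt{1-y}\end{pmatrix}U$$ is deterministic on $|\psi\rangle$: the two normalized outcomes $$|\phi_i\rangle=\frac{(A_i\otimes\mathbf{1}\otimes\mathbf{1})|\psi\rangle}{\|(A_i\otimes\mathbf{1}\otimes\mathbf{1})|\psi\rangle\|},\qquad i=0,1,$$ are locally unitarily equivalent to each other.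
   Context: States are unit vectors of $\mathbb{C}^2\otimes\mathbb{C}^2\otimes\mathbb{C}^2$. Two states are locally unitarily equivalent (in the same orbit) if one is mapped to the other by $U_A\otimes U_B\otimes U_C$ with $U_A,U_B,U_C\in U(2)$. A deterministic POVM is a local POVM all of whose outcomes lie in the same orbit. The condition $x\neq y$ expresses that the POVM is nontrivial (its elements are not proportional to unitaries), and $0<x,y<1$ that it is not a projective measurement. *)

theory Defs
  imports "HOL-Analysis.Analysis"
begin

text \<open>
  The numeral type \<open>2\<close> has the elements \<open>0\<close> and \<open>1\<close>, which label the
  computational basis of a qubit; the component of a state at \<open>(i, j, k)\<close> is its coefficient
  at \<open>|ijk>\<close>. The library norm on this space is the Hilbert space norm.
\<close>

type_synonym operator1 = "complex ^ 2 ^ 2"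
type_synonym vec3 = "complex ^ (2 \<times> 2 \<times> 2)"

definition ctranspose :: "complex ^ 'n ^ 'm \<Rightarrow> complex ^ 'm ^ 'n" where
  "ctranspose A = (\<chi> i j. cnj (A $ j $ i))"

definition unitary_mat :: "complex ^ 'n ^ 'n \<Rightarrow> bool" where
  "unitary_mat U \<longleftrightarrow> ctranspose U ** U = mat 1 \<and> U ** ctranspose U = mat 1"

definition kron :: "complex ^ 'n ^ 'm \<Rightarrow> complex ^ 'k ^ 'l \<Rightarrow> complex ^ ('n \<times> 'k) ^ ('m \<times> 'l)" where
  "kron A B = (\<chi> p q. A $ fst p $ fst q * B $ snd p $ snd q)"

definition lu_equiv :: "vec3 \<Rightarrow> vec3 \<Rightarrow> bool" where
  "lu_equiv \<psi> \<phi> \<longleftrightarrow>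
     (\<exists>(UA::operator1) (UB::operator1) (UC::operator1).
        unitary_mat UA \<and> unitary_mat UB \<and> unitary_mat UC \<and>
        kron UA (kron UB UC) *v \<psi> = \<phi>)"

definition density :: "vec3 \<Rightarrow> complex ^ (2 \<times> 2 \<times> 2) ^ (2 \<times> 2 \<times> 2)" where
  "density \<psi> = (\<chi> p q. \<psi> $ p * cnj (\<psi> $ q))"

definition reduced_A :: "vec3 \<Rightarrow> operator1" where
  "reduced_A \<psi> = (\<chi> i i'. \<Sum>j\<in>UNIV. \<Sum>k\<in>UNIV. density \<psi> $ (i, j, k) $ (i', j, k))"

definition reduced_B :: "vec3 \<Rightarrow> operator1" where
  "reduced_B \<psi> = (\<chi> j j'. \<Sum>i\<in>UNIV. \<Sum>k\<in>UNIV. density \<psi> $ (i, j, k) $ (i, j', k))"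

definition reduced_C :: "vec3 \<Rightarrow> operator1" where
  "reduced_C \<psi> = (\<chi> k k'. \<Sum>i\<in>UNIV. \<Sum>j\<in>UNIV. density \<psi> $ (i, j, k) $ (i, j, k'))"

definition genuinely_tripartite :: "vec3 \<Rightarrow> bool" where
  "genuinely_tripartite \<psi> \<longleftrightarrow>
     rank (reduced_A \<psi>) = 2 \<and> rank (reduced_B \<psi>) = 2 \<and> rank (reduced_C \<psi>) = 2"

definition real_state :: "vec3 \<Rightarrow> bool" where
  "real_state \<psi> \<longleftrightarrow> (\<exists>\<phi>. lu_equiv \<psi> \<phi> \<and> (\<forall>p. \<phi> $ p \<in> \<real>))"

text \<open>
  In the numeral type the literal \<open>2\<close> denotes \<open>0\<close>, so the list notation \<open>vector\<close> would
  put its first entry at index \<open>1\<close>. Here the first argument belongs to \<open>|0>\<close>.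
\<close>

definition diag2 :: "real \<Rightarrow> real \<Rightarrow> operator1" where
  "diag2 a b = (\<chi> i j. if i = j then complex_of_real (if i = 0 then a else b) else 0)"

definition on_first :: "operator1 \<Rightarrow> vec3 \<Rightarrow> vec3" where
  "on_first A \<psi> = kron A (kron (mat 1 :: operator1) (mat 1 :: operator1)) *v \<psi>"

definition outcome :: "operator1 \<Rightarrow> vec3 \<Rightarrow> vec3" where
  "outcome A \<psi> = (1 / norm (on_first A \<psi>)) *\<^sub>R on_first A \<psi>"

definition povm2 :: "operator1 \<Rightarrow> operator1 \<Rightarrow> bool" where
  "povm2 A0 A1 \<longleftrightarrow> ctranspose A0 ** A0 + ctranspose A1 ** A1 = mat 1"

text \<open>
  If an outcome had probability zero, \<open>outcome\<close> would be the zero vector. This does not occur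
  for invertible \<open>A0\<close> and \<open>A1\<close> and nonzero \<open>\<psi>\<close>.
\<close>

definition deterministic_povm2 :: "operator1 \<Rightarrow> operator1 \<Rightarrow> vec3 \<Rightarrow> bool" where
  "deterministic_povm2 A0 A1 \<psi> \<longleftrightarrow>
     povm2 A0 A1 \<and> lu_equiv (outcome A0 \<psi>) (outcome A1 \<psi>)"

end

theory Submission
  imports Defs
begin

text \<open>
  A real three-qubit state is a pair of real \<open>2 \<times> 2\<close> matrices, its slices along the first qubit.
  A real matrix is the sum of a complex-linear map \<open>v \<mapsto> z v\<close> and an antilinear map
  \<open>v \<mapsto> w (cnj v)\<close> of \<open>\<complex> = \<real>\<^sup>2\<close>, up to a factor. Conjugation by two planar reflections sends
  \<open>(z, w)\<close> to \<open>(\<alpha> cnj z, \<beta> cnj w)\<close> with arbitrary phases \<open>\<alpha>\<close>, \<open>\<beta>\<close>. Rotating the first qubit by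
  \<open>\<pi> / 2\<close> exchanges the slices up to sign, so by the intermediate value theorem some rotation
  makes \<open>(\<bar>z\<bar>, \<bar>w\<bar>)\<close> of one slice equal to \<open>q\<close> times that of the other. Then a pair of reflections on
  the last two qubits exchanges the slices \<open>M\<close> and \<open>N\<close> up to the factors \<open>1 / q\<close> and \<open>q\<close>. Combined
  with the bit flip on the first qubit it sends \<open>(sqrt x M, sqrt y N)\<close> to
  \<open>((sqrt y / q) M, (q sqrt x) N)\<close>, which is proportional to
  \<open>(sqrt (1 - x) M, sqrt (1 - y) N)\<close> as soon as \<open>y (1 - y) = q ^ 4 x (1 - x)\<close>.
\<close>

section \<open>Kronecker products and unitary matrices\<close>

lemma UNIV_2_01: "(UNIV :: 2 set) = {0, 1}"
proof -
  have "x = 0 \<or> x = 1" for x :: 2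
    using exhaust_2[of x] by auto
  then show ?thesis by auto
qed

lemma sum_2_01: "(\<Sum>i\<in>(UNIV :: 2 set). f i) = f 0 + (f 1 :: 'a::comm_monoid_add)"
  by (simp add: UNIV_2_01)

lemma all_2_01: "(\<forall>i::2. P i) \<longleftrightarrow> P 0 \<and> P 1"
  using UNIV_2_01 by (metis UNIV_I insert_iff singletonD)

lemma kron_mult: "kron A B ** kron C D = kron (A ** C) (B ** D)"
  by (simp add: vec_eq_iff kron_def matrix_matrix_mult_def sum_product UNIV_Times_UNIV[symmetric]
      sum.cartesian_product' mult_ac del: UNIV_Times_UNIV)

lemma ctranspose_kron: "ctranspose (kron A B) = kron (ctranspose A) (ctranspose B)"
  by (simp add: vec_eq_iff kron_def ctranspose_def)

lemma kron_mat_1: "kron (mat 1) (mat 1) = mat 1"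
  by (auto simp: vec_eq_iff kron_def mat_def prod_eq_iff)

lemma unitary_kron: "unitary_mat A \<Longrightarrow> unitary_mat B \<Longrightarrow> unitary_mat (kron A B)"
  by (simp add: unitary_mat_def ctranspose_kron kron_mult kron_mat_1)

lemma ctranspose_mult: "ctranspose (A ** B) = ctranspose B ** ctranspose A"
  by (simp add: vec_eq_iff ctranspose_def matrix_matrix_mult_def mult.commute)

lemma ctranspose_ctranspose: "ctranspose (ctranspose A) = A"
  by (simp add: vec_eq_iff ctranspose_def)

lemma unitary_mult: "unitary_mat A \<Longrightarrow> unitary_mat B \<Longrightarrow> unitary_mat (A ** B)"
  unfolding unitary_mat_def ctranspose_mult
  by (metis matrix_mul_assoc matrix_mul_rid)

lemma unitary_ctranspose: "unitary_mat A \<Longrightarrow> unitary_mat (ctranspose A)"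
  by (simp add: unitary_mat_def ctranspose_ctranspose)

lemma unitary_mat_1: "unitary_mat (mat 1)"
proof -
  have "ctranspose (mat 1 :: complex ^ 'n ^ 'n) = mat 1"
    by (auto simp: vec_eq_iff ctranspose_def mat_def)
  then show ?thesis by (simp add: unitary_mat_def)
qed

text \<open>Moving \<open>U\<close> across the inner product as its adjoint turns
  \<open><Uv, Uv>\<close> into \<open><v, v>\<close>.\<close>

lemma norm_unitary_mult:
  fixes v :: "complex ^ 'n"
  assumes "unitary_mat U"
  shows "norm (U *v v) = norm v"
proof -
  have sq: "complex_of_real ((norm w)\<^sup>2) = (\<Sum>i\<in>UNIV. cnj (w $ i) * w $ i)" for w :: "complex ^ 'n"
    by (simp add: norm_vec_def L2_set_def sum_nonneg complex_norm_square mult.commute flip: of_real_power)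
  define w where "w = U *v v"
  have "(\<Sum>i\<in>UNIV. cnj (w $ i) * w $ i)
      = (\<Sum>i\<in>UNIV. \<Sum>j\<in>UNIV. cnj (v $ j) * (ctranspose U $ j $ i * w $ i))"
  proof (rule sum.cong[OF refl])
    fix i
    have "cnj (w $ i) = (\<Sum>j\<in>UNIV. cnj (v $ j) * ctranspose U $ j $ i)"
      by (simp add: w_def ctranspose_def matrix_vector_mult_def mult.commute)
    then show "cnj (w $ i) * w $ i = (\<Sum>j\<in>UNIV. cnj (v $ j) * (ctranspose U $ j $ i * w $ i))"
      by (simp add: sum_distrib_right mult.assoc)
  qed
  also have "\<dots> = (\<Sum>j\<in>UNIV. cnj (v $ j) * (ctranspose U *v w) $ j)"
    by (subst sum.swap) (simp add: matrix_vector_mult_def sum_distrib_left)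
  also have "ctranspose U *v w = v"
    using assms by (simp add: w_def unitary_mat_def matrix_vector_mul_assoc)
  finally have "complex_of_real ((norm w)\<^sup>2) = complex_of_real ((norm v)\<^sup>2)"
    by (simp only: sq)
  then show ?thesis by (simp add: w_def del: of_real_power)
qed

lemma matrix_scaleR_right:
  fixes A :: "complex ^ 'n ^ 'm"
  shows "A *v (r *\<^sub>R v) = r *\<^sub>R (A *v v)"
  by (simp add: vec_eq_iff matrix_vector_mult_def scaleR_sum_right)

section \<open>Local unitary equivalence\<close>

lemma lu_equivI:
  "unitary_mat UA \<Longrightarrow> unitary_mat UB \<Longrightarrow> unitary_mat UC \<Longrightarrow>
    kron UA (kron UB UC) *v \<psi> = \<phi> \<Longrightarrow> lu_equiv \<psi> \<phi>"
  unfolding lu_equiv_def by blast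

lemma lu_equiv_trans:
  assumes "lu_equiv \<psi> \<phi>" "lu_equiv \<phi> \<eta>"
  shows "lu_equiv \<psi> \<eta>"
proof -
  obtain UA UB UC where 1: "unitary_mat UA" "unitary_mat UB" "unitary_mat UC"
    "kron UA (kron UB UC) *v \<psi> = \<phi>" using assms(1) unfolding lu_equiv_def by blast
  obtain VA VB VC where 2: "unitary_mat VA" "unitary_mat VB" "unitary_mat VC"
    "kron VA (kron VB VC) *v \<phi> = \<eta>" using assms(2) unfolding lu_equiv_def by blast
  show ?thesis
    by (rule lu_equivI[of "VA ** UA" "VB ** UB" "VC ** UC"])
      (use 1 2 in \<open>auto simp: unitary_mult matrix_vector_mul_assoc kron_mult\<close>)
qed

lemma lu_equiv_sym:
  assumes "lu_equiv \<psi> \<phi>"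
  shows "lu_equiv \<phi> \<psi>"
proof -
  obtain UA UB UC where 1: "unitary_mat UA" "unitary_mat UB" "unitary_mat UC"
    "kron UA (kron UB UC) *v \<psi> = \<phi>" using assms unfolding lu_equiv_def by blast
  show ?thesis
  proof (rule lu_equivI[of "ctranspose UA" "ctranspose UB" "ctranspose UC"])
    show "kron (ctranspose UA) (kron (ctranspose UB) (ctranspose UC)) *v \<phi> = \<psi>"
      unfolding 1(4)[symmetric] using 1(1-3)
      by (simp add: matrix_vector_mul_assoc kron_mult unitary_mat_def kron_mat_1)
  qed (use 1 in \<open>auto simp: unitary_ctranspose\<close>)
qed

lemma lu_equiv_scaleR: "lu_equiv \<psi> \<phi> \<Longrightarrow> lu_equiv (r *\<^sub>R \<psi>) (r *\<^sub>R \<phi>)"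
  unfolding lu_equiv_def matrix_scaleR_right by metis

lemma lu_equiv_norm: "lu_equiv \<psi> \<phi> \<Longrightarrow> norm \<psi> = norm \<phi>"
  unfolding lu_equiv_def using norm_unitary_mult unitary_kron by metis

text \<open>Local unitaries preserve the norm, so \<kappa> is the ratio of the two norms and cancels
  on normalization.\<close>

lemma lu_equiv_outcome:
  assumes "lu_equiv (on_first A0 \<psi>) (\<kappa> *\<^sub>R on_first A1 \<psi>)" "\<kappa> > 0"
  shows "lu_equiv (outcome A0 \<psi>) (outcome A1 \<psi>)"
proof -
  have "norm (on_first A0 \<psi>) = \<kappa> * norm (on_first A1 \<psi>)"
    using lu_equiv_norm[OF assms(1)] assms(2) by simp
  then show ?thesis
    using lu_equiv_scaleR[OF assms(1), of "1 / norm (on_first A0 \<psi>)"] assms(2)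
    by (simp add: outcome_def)
qed

section \<open>Coordinates and the slices along the first qubit\<close>

lemma kron3_component:
  fixes A B C :: operator1 and \<psi> :: vec3
  shows "(kron A (kron B C) *v \<psi>) $ (i, j, k) =
    (\<Sum>i'\<in>UNIV. \<Sum>j'\<in>UNIV. \<Sum>k'\<in>UNIV. A $ i $ i' * B $ j $ j' * C $ k $ k' * \<psi> $ (i', j', k'))"
  by (simp add: kron_def matrix_vector_mult_def UNIV_Times_UNIV[symmetric]
      sum.cartesian_product' mult_ac del: UNIV_Times_UNIV)

lemma on_first_component:
  "on_first A \<psi> $ (i, j, k) = A $ i $ 0 * \<psi> $ (0, j, k) + A $ i $ 1 * \<psi> $ (1, j, k)"
  by (simp add: on_first_def kron3_component sum_2_01 mat_def)
     (use all_2_01[of "\<lambda>j. j = 0 \<or> j = 1"] in auto)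

text \<open>\<open>reduced_A\<close> is the Gram matrix of the two slices. A linear relation between
  the slices annihilates it from the left, but rank 2 makes it invertible.\<close>

lemma rank_reduced_A_independent:
  assumes "rank (reduced_A \<psi>) = 2"
    and "\<And>j k. a * \<psi> $ (0, j, k) + b * \<psi> $ (1, j, k) = 0"
  shows "a = 0 \<and> b = 0"
proof -
  define v :: "complex ^ 2" where "v = (\<chi> i. if i = 0 then a else b)"
  have "(\<Sum>i\<in>UNIV. v $ i * reduced_A \<psi> $ i $ i') = 0" for i'
  proof -
    have "(\<Sum>i\<in>UNIV. v $ i * reduced_A \<psi> $ i $ i') =
      (\<Sum>j\<in>UNIV. \<Sum>k\<in>UNIV. (a * \<psi> $ (0, j, k) + b * \<psi> $ (1, j, k)) * cnj (\<psi> $ (i', j, k)))"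
      by (simp add: reduced_A_def density_def v_def sum_2_01 algebra_simps)
    then show ?thesis by (simp add: assms(2))
  qed
  then have "v v* reduced_A \<psi> = 0"
    by (simp add: vec_eq_iff vector_matrix_mult_def mult.commute)
  moreover obtain B where "reduced_A \<psi> ** B = mat 1"
  proof -
    have "vec.span (rows (reduced_A \<psi>)) = UNIV"
      using assms(1) by (simp add: row_rank_def_gen vec.dim_eq_full[symmetric] vec.dimension_def card_cart_basis)
    then show ?thesis
      using that matrix_left_invertible_span_rows_gen matrix_left_right_inverse by blast
  qed
  ultimately have "v = 0"
    by (metis vector_matrix_mul_assoc vector_matrix_mul_rid vector_matrix_mult_0)
  then show ?thesis
    by (simp add: v_def vec_eq_iff all_2_01)
qed

section \<open>Scalar equations: ratios, phases, the balancing angle and the probabilities\<close>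

lemma proportional_factor:
  fixes f g f' g' :: real
  assumes "f \<ge> 0" "g \<ge> 0" "f' \<ge> 0" "g' \<ge> 0" "f + g > 0" "f' + g' > 0"
    and "f * g' = f' * g"
  obtains r where "r > 0" "f = r * f'" "g = r * g'"
proof
  \<comment> \<open>One of \<open>f'\<close> and \<open>g'\<close> may vanish, so the ratio of the
    sums serves as the factor.\<close>
  show "(f + g) / (f' + g') > 0" using assms by simp
  have "f * (f' + g') = (f + g) * f'" "g * (f' + g') = (f + g) * g'"
    using assms(7) by algebra+
  then show "f = (f + g) / (f' + g') * f'" "g = (f + g) / (f' + g') * g'"
    using assms(6) by (simp_all add: field_simps)
qed

text \<open>The phase \<open>Arg z + Arg z'\<close> is symmetric in \<open>z\<close> and
  \<open>z'\<close>, so the same reflection works in both directions.\<close>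

lemma norm_eq_reflection:
  assumes "norm z = q * norm z'" "q > 0"
  obtains \<theta> where "z = of_real q * cis \<theta> * cnj z'" "z' = of_real (1 / q) * cis \<theta> * cnj z"
proof
  define \<theta> where "\<theta> = Arg z + Arg z'"
  have z: "z = of_real (norm z) * cis (Arg z)" and z': "z' = of_real (norm z') * cis (Arg z')"
    by (metis rcis_cmod_Arg rcis_def)+
  have "cis \<theta> * cnj z' = of_real (norm z') * cis (Arg z)"
    by (subst z') (simp add: \<theta>_def cis_cnj cis_mult mult_ac)
  then show "z = of_real q * cis \<theta> * cnj z'"
    by (subst z) (simp add: assms(1))
  have "cis \<theta> * cnj z = of_real (norm z) * cis (Arg z')"
    by (subst z) (simp add: \<theta>_def cis_cnj cis_mult mult_ac)
  then show "z' = of_real (1 / q) * cis \<theta> * cnj z"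
    by (subst z') (use assms in simp)
qed

text \<open>Equality of two ratios, cross-multiplied so that vanishing norms are allowed. At
  \<open>pi / 2\<close> the two products have traded places compared with 0, so their difference
  changes sign.\<close>

lemma balanced_angle:
  fixes z z' w w' :: complex
  obtains t where
    "norm (cos t *\<^sub>R z + sin t *\<^sub>R z') * norm (- sin t *\<^sub>R w + cos t *\<^sub>R w') =
     norm (- sin t *\<^sub>R z + cos t *\<^sub>R z') * norm (cos t *\<^sub>R w + sin t *\<^sub>R w')"
proof -
  define h where "h t =
    norm (cos t *\<^sub>R z + sin t *\<^sub>R z') * norm (- sin t *\<^sub>R w + cos t *\<^sub>R w') -
    norm (- sin t *\<^sub>R z + cos t *\<^sub>R z') * norm (cos t *\<^sub>R w + sin t *\<^sub>R w')" for t
  have cont: "continuous_on A h" for A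
    unfolding h_def by (intro continuous_intros)
  have "h (pi / 2) = - h 0"
    by (simp add: h_def)
  then have "\<exists>t. h t = 0"
    using IVT'[of h 0 0 "pi / 2"] IVT2'[of h "pi / 2" 0 0] cont
    by (cases "h 0 \<le> 0") force+
  then show ?thesis
    using that by (auto simp: h_def)
qed

text \<open>Eliminating \<kappa> leaves \<open>y * (1 - y) = q ^ 4 * (x * (1 - x))\<close>.
  Depending on the size of \<open>q\<close>, one of \<open>x\<close>, \<open>y\<close> is set to
  1/3, where the product is 2/9, and a quadratic is solved for the other.\<close>

lemma probabilities_exist:
  fixes q :: real
  assumes "q > 0"
  obtains x y \<kappa> where "0 < x" "x < 1" "0 < y" "y < 1" "x \<noteq> y" "\<kappa> > 0"
    "sqrt y / q = \<kappa> * sqrt (1 - x)" "sqrt x * q = \<kappa> * sqrt (1 - y)"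
proof -
  \<comment> \<open>The bound \<open>r \<le> 1\<close> keeps the discriminant positive. The larger
    root is at least 1/2, so it differs from 1/3 even when \<open>q = 1\<close>.\<close>
  have root: "\<exists>y. 1/3 < y \<and> y < 1 \<and> y * (1 - y) = 2/9 * r" if "0 < r" "r \<le> 1" for r :: real
  proof (intro exI conjI)
    define s where "s = sqrt (1 - 8/9 * r)"
    have s2: "s * s = 1 - 8/9 * r" and "s \<ge> 0" "s < 1"
      using that by (simp_all add: s_def)
    then show "1/3 < (1 + s) / 2" "(1 + s) / 2 < 1"
      by auto
    show "(1 + s) / 2 * (1 - (1 + s) / 2) = 2/9 * r"
      using s2 by (simp add: field_simps)
  qed
  have "\<exists>x y. 0 < x \<and> x < 1 \<and> 0 < y \<and> y < 1 \<and> x \<noteq> y \<and> y * (1 - y) = q ^ 4 * (x * (1 - x))"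
  proof (cases "q \<le> 1")
    case True
    then have "q ^ 4 \<le> 1" using assms by (simp add: power_le_one)
    then obtain y where "1/3 < y" "y < 1" "y * (1 - y) = 2/9 * q ^ 4"
      using root[of "q ^ 4"] assms by auto
    then show ?thesis
      by (intro exI[of _ "1/3"] exI[of _ y]) auto
  next
    case False
    then have "1 / q ^ 4 \<le> 1" by simp
    then obtain x where "1/3 < x" "x < 1" "x * (1 - x) = 2/9 * (1 / q ^ 4)"
      using root[of "1 / q ^ 4"] assms by auto
    then show ?thesis
      using assms by (intro exI[of _ x] exI[of _ "1/3"]) auto
  qed
  then obtain x y where xy: "0 < x" "x < 1" "0 < y" "y < 1" "x \<noteq> y"
    and eq: "y * (1 - y) = q ^ 4 * (x * (1 - x))"
    by blast
  define \<kappa> where "\<kappa> = sqrt x * q / sqrt (1 - y)"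
  have "sqrt (q ^ 4) = q\<^sup>2"
    by (rule real_sqrt_unique) simp_all
  then have "sqrt y * sqrt (1 - y) = q\<^sup>2 * (sqrt x * sqrt (1 - x))"
    using arg_cong[OF eq, of sqrt] by (simp add: real_sqrt_mult)
  then have "sqrt y / q = \<kappa> * sqrt (1 - x)"
    using assms xy by (simp add: \<kappa>_def field_simps power2_eq_square)
  moreover have "\<kappa> > 0" "sqrt x * q = \<kappa> * sqrt (1 - y)"
    using assms xy by (simp_all add: \<kappa>_def)
  ultimately show ?thesis
    using that xy by blast
qed

section \<open>Rotations, reflections and real matrices as maps of the complex plane\<close>

definition rot :: "real \<Rightarrow> operator1" where
  "rot t = (\<chi> i j. of_real (if i = j then cos t else if i = 0 then sin t else - sin t))"

text \<open>The reflection of the plane in the line at angle \<open>t / 2\<close>, with real entries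
  so that identities between slices stay in real arithmetic.\<close>

definition reflection :: "real \<Rightarrow> 2 \<Rightarrow> 2 \<Rightarrow> real" where
  "reflection t i j = (if i \<noteq> j then sin t else if i = 0 then cos t else - cos t)"

definition reflection_mat :: "real \<Rightarrow> operator1" where
  "reflection_mat t = (\<chi> i j. of_real (reflection t i j))"

definition swap_mat :: operator1 where
  "swap_mat = (\<chi> i j. if i = j then 0 else 1)"

lemma complex_sin_cos_1:
  "complex_of_real (sin t) * of_real (sin t) + of_real (cos t) * of_real (cos t) = 1"
  by (metis of_real_1 of_real_add of_real_mult power2_eq_square sin_cos_squared_add)

lemma unitary_rot: "unitary_mat (rot t)"
  using complex_sin_cos_1[of t]
  by (simp add: unitary_mat_def ctranspose_def rot_def vec_eq_iff matrix_matrix_mult_def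
      all_2_01 sum_2_01 mat_def algebra_simps)

lemma unitary_reflection: "unitary_mat (reflection_mat t)"
  using complex_sin_cos_1[of t]
  by (simp add: unitary_mat_def ctranspose_def reflection_mat_def reflection_def vec_eq_iff
      matrix_matrix_mult_def all_2_01 sum_2_01 mat_def algebra_simps)

lemma unitary_swap: "unitary_mat swap_mat"
  by (simp add: unitary_mat_def ctranspose_def swap_mat_def vec_eq_iff
      matrix_matrix_mult_def all_2_01 sum_2_01 mat_def)

text \<open>
  On \<open>\<complex> = \<real>\<^sup>2\<close> a real matrix \<open>M\<close> acts as \<open>v \<mapsto> (z v + w (cnj v)) / 2\<close> with \<open>z = lin_part M\<close>
  and \<open>w = antilin_part M\<close>, and \<open>reflection a\<close> acts as \<open>v \<mapsto> cis a (cnj v)\<close>.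
\<close>

definition lin_part :: "(2 \<Rightarrow> 2 \<Rightarrow> real) \<Rightarrow> complex" where
  "lin_part M = Complex (M 0 0 + M 1 1) (M 1 0 - M 0 1)"

definition antilin_part :: "(2 \<Rightarrow> 2 \<Rightarrow> real) \<Rightarrow> complex" where
  "antilin_part M = Complex (M 0 0 - M 1 1) (M 1 0 + M 0 1)"

lemma parts_eq_0:
  assumes "lin_part M = 0" "antilin_part M = 0"
  shows "M j k = 0"
proof -
  have "\<forall>j k. M j k = 0"
    using assms by (simp add: lin_part_def antilin_part_def complex_eq_iff all_2_01)
  then show ?thesis by blast
qed

text \<open>If \<open>N\<close> acts with parts \<open>z\<close> and \<open>w\<close>, composing it
  with \<open>reflection b\<close> before and \<open>reflection a\<close> after gives the parts
  \<open>cis (a - b) * cnj z\<close> and \<open>cis (a + b) * cnj w\<close>. The two parts determine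
  a matrix.\<close>

lemma reflection_conjugate:
  assumes "lin_part M = of_real q * cis (a - b) * cnj (lin_part N)"
    and "antilin_part M = of_real q * cis (a + b) * cnj (antilin_part N)"
  shows "M j k = q * (\<Sum>j'\<in>UNIV. \<Sum>k'\<in>UNIV. reflection a j j' * reflection b k k' * N j' k')"
proof -
  have "\<forall>j k. M j k = q * (\<Sum>j'\<in>UNIV. \<Sum>k'\<in>UNIV. reflection a j j' * reflection b k k' * N j' k')"
    using assms
    by (simp add: lin_part_def antilin_part_def complex_eq_iff all_2_01 sum_2_01 reflection_def
        cos_diff sin_diff cos_add sin_add) (intro conjI; elim conjE; simp only: algebra_simps; linarith)
  then show ?thesis by blast
qed

lemma swapping_reflections:
  assumes "norm (lin_part M) = q * norm (lin_part N)"
    and "norm (antilin_part M) = q * norm (antilin_part N)" "q > 0"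
  obtains a b where
    "\<And>j k. M j k = q * (\<Sum>j'\<in>UNIV. \<Sum>k'\<in>UNIV. reflection a j j' * reflection b k k' * N j' k')"
    "\<And>j k. N j k = (1 / q) * (\<Sum>j'\<in>UNIV. \<Sum>k'\<in>UNIV. reflection a j j' * reflection b k k' * M j' k')"
proof -
  obtain \<theta> where \<theta>: "lin_part M = of_real q * cis \<theta> * cnj (lin_part N)"
    "lin_part N = of_real (1 / q) * cis \<theta> * cnj (lin_part M)"
    using norm_eq_reflection assms by blast
  obtain \<theta>' where \<theta>': "antilin_part M = of_real q * cis \<theta>' * cnj (antilin_part N)"
    "antilin_part N = of_real (1 / q) * cis \<theta>' * cnj (antilin_part M)"
    using norm_eq_reflection assms by blast
  \<comment> \<open>The solution of \<open>a - b = \<theta>\<close>,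
    \<open>a + b = \<theta>'\<close>: both phases can be prescribed independently.\<close>
  define a b where "a = (\<theta> + \<theta>') / 2" and "b = (\<theta>' - \<theta>) / 2"
  have "\<theta> = a - b" "\<theta>' = a + b"
    by (simp_all add: a_def b_def field_simps)
  with \<theta> \<theta>' show ?thesis
    using that[of a b] reflection_conjugate by blast
qed

text \<open>Undoing \<open>UB\<close> and \<open>UC\<close> leaves a combination of the slices of
  \<psi> with row \<open>i\<close> of \<open>U\<close> as coefficients. If it vanished, independence
  would make that row zero, but a row of a unitary has length 1.\<close>

lemma slice_nonzero:
  fixes U UB UC :: operator1
  assumes "rank (reduced_A \<psi>) = 2" "unitary_mat U" "unitary_mat UB" "unitary_mat UC"
  shows "\<exists>j k. (kron U (kron UB UC) *v \<psi>) $ (i, j, k) \<noteq> 0"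
proof (rule ccontr)
  define \<omega> where "\<omega> = kron U (kron UB UC) *v \<psi>"
  assume "\<not> ?thesis"
  then have 0: "\<omega> $ (i, j, k) = 0" for j k
    by (auto simp: \<omega>_def)
  have "on_first U \<psi> = kron (mat 1) (kron (ctranspose UB) (ctranspose UC)) *v \<omega>"
    using assms(3,4) by (simp add: on_first_def \<omega>_def matrix_vector_mul_assoc kron_mult unitary_mat_def)
  then have "on_first U \<psi> $ (i, j, k) = 0" for j k
    using 0 by (simp add: kron3_component mat_def) (auto intro!: sum.neutral)
  then have "U $ i $ 0 * \<psi> $ (0, j, k) + U $ i $ 1 * \<psi> $ (1, j, k) = 0" for j k
    by (simp add: on_first_component)
  then have "U $ i $ 0 = 0 \<and> U $ i $ 1 = 0"
    by (rule rank_reduced_A_independent[OF assms(1)])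
  moreover have "(U ** ctranspose U) $ i $ i = 1"
    using assms(2) by (simp add: unitary_mat_def mat_def)
  ultimately show False
    by (simp add: matrix_matrix_mult_def sum_2_01)
qed

section \<open>The diagonal POVM and the assembly of the proof\<close>

lemma ctranspose_diag2: "ctranspose (diag2 a b) = diag2 a b"
  by (auto simp: ctranspose_def diag2_def vec_eq_iff)

lemma matrix_add_rdistrib:
  fixes A B :: "'a::semiring_1 ^ 'n ^ 'm"
  shows "(A + B) ** C = A ** C + B ** C"
  by (simp add: vec_eq_iff matrix_matrix_mult_def distrib_right sum.distrib)

lemma povm2_diag2:
  assumes "unitary_mat U" "0 \<le> x" "x \<le> 1" "0 \<le> y" "y \<le> 1"
  shows "povm2 (diag2 (sqrt x) (sqrt y) ** U) (diag2 (sqrt (1 - x)) (sqrt (1 - y)) ** U)"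
proof -
  have sq: "complex_of_real (sqrt r) * of_real (sqrt r) = of_real r" if "0 \<le> r" for r
    using that by (metis of_real_mult real_sqrt_mult_self abs_of_nonneg)
  let ?E = "diag2 (sqrt x) (sqrt y) ** diag2 (sqrt x) (sqrt y)"
  let ?F = "diag2 (sqrt (1 - x)) (sqrt (1 - y)) ** diag2 (sqrt (1 - x)) (sqrt (1 - y))"
  have "?E + ?F = mat 1"
    using assms by (simp add: diag2_def vec_eq_iff matrix_matrix_mult_def all_2_01 sum_2_01 mat_def sq)
  then have "ctranspose U ** ((?E + ?F) ** U) = mat 1"
    using assms(1) by (simp add: unitary_mat_def)
  then show ?thesis
    by (simp add: povm2_def ctranspose_mult ctranspose_diag2 matrix_add_ldistrib
        matrix_add_rdistrib matrix_mul_assoc)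
qed

theorem mainTheorem3:
  fixes \<psi> :: "complex ^ (2 \<times> 2 \<times> 2)"
  assumes "norm \<psi> = 1"
    and "genuinely_tripartite \<psi>"
    and "real_state \<psi>"
  shows "\<exists>(U :: complex ^ 2 ^ 2) (x :: real) (y :: real).
           unitary_mat U \<and> 0 < x \<and> x < 1 \<and> 0 < y \<and> y < 1 \<and> x \<noteq> y \<and>
           deterministic_povm2
             (diag2 (sqrt x) (sqrt y) ** U)
             (diag2 (sqrt (1 - x)) (sqrt (1 - y)) ** U) \<psi>"
proof -
  obtain \<phi> UA UB UC where UA: "unitary_mat UA" and UB: "unitary_mat UB" and UC: "unitary_mat UC"
    and \<phi>: "kron UA (kron UB UC) *v \<psi> = \<phi>" and real: "\<And>p. \<phi> $ p \<in> \<real>"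
    using assms(3) unfolding real_state_def lu_equiv_def by blast
  define P where "P i j k = Re (\<phi> $ (i, j, k))" for i j k
  have P: "\<phi> $ (i, j, k) = of_real (P i j k)" for i j k
    using real by (simp add: P_def)
  obtain t where t: "norm (cos t *\<^sub>R lin_part (P 0) + sin t *\<^sub>R lin_part (P 1)) *
        norm (- sin t *\<^sub>R antilin_part (P 0) + cos t *\<^sub>R antilin_part (P 1)) =
      norm (- sin t *\<^sub>R lin_part (P 0) + cos t *\<^sub>R lin_part (P 1)) *
        norm (cos t *\<^sub>R antilin_part (P 0) + sin t *\<^sub>R antilin_part (P 1))"
    using balanced_angle by blast
  \<comment> \<open>The slices of the real state after the rotation of the first qubit.\<close>
  define M where "M j k = cos t * P 0 j k + sin t * P 1 j k" for j k
  define N where "N j k = - sin t * P 0 j k + cos t * P 1 j k" for j k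
  have balanced: "norm (lin_part M) * norm (antilin_part N) = norm (lin_part N) * norm (antilin_part M)"
  proof -
    have "lin_part M = cos t *\<^sub>R lin_part (P 0) + sin t *\<^sub>R lin_part (P 1)"
      "lin_part N = - sin t *\<^sub>R lin_part (P 0) + cos t *\<^sub>R lin_part (P 1)"
      "antilin_part M = cos t *\<^sub>R antilin_part (P 0) + sin t *\<^sub>R antilin_part (P 1)"
      "antilin_part N = - sin t *\<^sub>R antilin_part (P 0) + cos t *\<^sub>R antilin_part (P 1)"
      by (simp_all add: M_def N_def lin_part_def antilin_part_def complex_eq_iff algebra_simps)
    then show ?thesis using t by simp
  qed
  define U where "U = rot t ** UA"
  have U: "unitary_mat U"
    by (simp add: U_def UA unitary_mult unitary_rot)
  have rot_\<phi>: "on_first (D ** rot t) \<phi> = kron (D ** U) (kron UB UC) *v \<psi>" for D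
    by (simp add: on_first_def U_def \<phi>[symmetric] matrix_vector_mul_assoc kron_mult matrix_mul_assoc)
  have slices: "on_first (diag2 a b ** rot t) \<phi> $ (0, j, k) = of_real (a * M j k)"
    "on_first (diag2 a b ** rot t) \<phi> $ (1, j, k) = of_real (b * N j k)" for a b j k
    by (simp_all add: on_first_component P matrix_matrix_mult_def sum_2_01 diag2_def rot_def
        M_def N_def algebra_simps)
  \<comment> \<open>The trivial measurement makes \<open>slices\<close> describe the rotated state
    itself, so that \<open>slice_nonzero\<close> applies to \<open>M\<close> and
    \<open>N\<close>.\<close>
  have "diag2 1 1 = mat 1"
    by (auto simp: diag2_def mat_def vec_eq_iff)
  then have "kron U (kron UB UC) *v \<psi> = on_first (diag2 1 1 ** rot t) \<phi>"
    by (metis rot_\<phi> matrix_mul_lid)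
  then have "(kron U (kron UB UC) *v \<psi>) $ (0, j, k) = of_real (M j k)"
    "(kron U (kron UB UC) *v \<psi>) $ (1, j, k) = of_real (N j k)" for j k
    using slices[of 1 1] by simp_all
  moreover have "rank (reduced_A \<psi>) = 2"
    using assms(2) by (simp add: genuinely_tripartite_def)
  ultimately have "\<exists>j k. M j k \<noteq> 0" "\<exists>j k. N j k \<noteq> 0"
    using slice_nonzero[OF _ U UB UC] by (metis of_real_0)+
  then have "norm (lin_part M) + norm (antilin_part M) > 0"
    "norm (lin_part N) + norm (antilin_part N) > 0"
    using parts_eq_0 by (metis add_nonneg_pos add_pos_nonneg norm_ge_zero zero_less_norm_iff)+
  then obtain q where q: "q > 0" "norm (lin_part M) = q * norm (lin_part N)"
    "norm (antilin_part M) = q * norm (antilin_part N)"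
    using proportional_factor balanced by (metis norm_ge_zero)
  obtain a b where
    ab: "\<And>j k. M j k = q * (\<Sum>j'\<in>UNIV. \<Sum>k'\<in>UNIV. reflection a j j' * reflection b k k' * N j' k')"
    "\<And>j k. N j k = (1 / q) * (\<Sum>j'\<in>UNIV. \<Sum>k'\<in>UNIV. reflection a j j' * reflection b k k' * M j' k')"
    using swapping_reflections[OF q(2,3,1)] by blast
  obtain x y \<kappa> where xy: "0 < x" "x < 1" "0 < y" "y < 1" "x \<noteq> y" and \<kappa>: "\<kappa> > 0"
    "sqrt y / q = \<kappa> * sqrt (1 - x)" "sqrt x * q = \<kappa> * sqrt (1 - y)"
    using probabilities_exist[OF q(1)] by blast
  define D0 D1 where "D0 = diag2 (sqrt x) (sqrt y)" and "D1 = diag2 (sqrt (1 - x)) (sqrt (1 - y))"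
  \<comment> \<open>\<open>UB\<close> and \<open>UC\<close> commute with operators on the first
    qubit, so measuring \<psi> can be replaced by measuring the real state.\<close>
  have to_real: "lu_equiv (on_first (D ** U) \<psi>) (on_first (D ** rot t) \<phi>)" for D
  proof (rule lu_equivI[OF unitary_mat_1 UB UC])
    show "kron (mat 1) (kron UB UC) *v on_first (D ** U) \<psi> = on_first (D ** rot t) \<phi>"
      unfolding rot_\<phi> by (simp add: on_first_def matrix_vector_mul_assoc kron_mult)
  qed
  \<comment> \<open>The bit flip puts \<open>sqrt y\<close> on the reflected \<open>N\<close>, which
    is \<open>M / q\<close>, and \<open>sqrt x\<close> on the reflected \<open>M\<close>, which is
    \<open>q N\<close>; the choice of \<kappa> matches both slices at once.\<close>
  have "kron swap_mat (kron (reflection_mat a) (reflection_mat b)) *v on_first (D0 ** rot t) \<phi> =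
      \<kappa> *\<^sub>R on_first (D1 ** rot t) \<phi>" (is "?L = ?R")
  proof -
    have "?L $ (0, j, k) = ?R $ (0, j, k)" for j k
    proof -
      have "?L $ (0, j, k) = of_real (sqrt y *
          (\<Sum>j'\<in>UNIV. \<Sum>k'\<in>UNIV. reflection a j j' * reflection b k k' * N j' k'))"
        by (simp add: kron3_component sum_2_01 swap_mat_def reflection_mat_def D0_def slices algebra_simps)
      also have "\<dots> = of_real (sqrt y / q * M j k)"
        using q(1) by (subst ab(1)) simp
      also have "\<dots> = ?R $ (0, j, k)"
        unfolding \<kappa>(2)
        by (simp add: D1_def slices scaleR_conv_of_real[where 'a=complex] mult_ac)
      finally show ?thesis .
    qed
    moreover have "?L $ (1, j, k) = ?R $ (1, j, k)" for j k
    proof -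
      have "?L $ (1, j, k) = of_real (sqrt x *
          (\<Sum>j'\<in>UNIV. \<Sum>k'\<in>UNIV. reflection a j j' * reflection b k k' * M j' k'))"
        by (simp add: kron3_component sum_2_01 swap_mat_def reflection_mat_def D0_def slices algebra_simps)
      also have "\<dots> = of_real (sqrt x * q * N j k)"
        using q(1) by (subst ab(2)) simp
      also have "\<dots> = ?R $ (1, j, k)"
        unfolding \<kappa>(3)
        by (simp add: D1_def slices scaleR_conv_of_real[where 'a=complex] mult_ac)
      finally show ?thesis .
    qed
    ultimately have "\<forall>i j k. ?L $ (i, j, k) = ?R $ (i, j, k)"
      using all_2_01[of "\<lambda>i. \<forall>j k. ?L $ (i, j, k) = ?R $ (i, j, k)"] by blast
    then show ?thesis
      by (simp add: vec_eq_iff)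
  qed
  then have "lu_equiv (on_first (D0 ** rot t) \<phi>) (\<kappa> *\<^sub>R on_first (D1 ** rot t) \<phi>)"
    by (intro lu_equivI[OF unitary_swap unitary_reflection unitary_reflection])
  then have "lu_equiv (on_first (D0 ** U) \<psi>) (\<kappa> *\<^sub>R on_first (D1 ** U) \<psi>)"
    by (meson to_real lu_equiv_trans lu_equiv_sym lu_equiv_scaleR)
  then have "lu_equiv (outcome (D0 ** U) \<psi>) (outcome (D1 ** U) \<psi>)"
    using \<kappa>(1) by (rule lu_equiv_outcome)
  moreover have "povm2 (D0 ** U) (D1 ** U)"
    unfolding D0_def D1_def using U xy by (intro povm2_diag2) auto
  ultimately show ?thesis
    using U xy unfolding deterministic_povm2_def D0_def D1_def by blast
qed

end
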